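(* The involutory monoids $2\mathfrak{Cob}^\circ_1$, $\overline{2\mathfrak{Cob}^\circ_1}$, $\mathfrak L^\flat_2$ and $\overline{\mathfrak L^\flat_2}$ with involution ${}^\sigma$ are finitely based. More precisely, for $i,j\in\{0,1,3\}$ let $(\mathrm{I})_{ij}$ and $(\mathrm{II})_{ij}$ be the identities obtained from $$(\mathrm I)\quad xt_1yt_2\cdot xy\cdot t_3yt_4x\bumpeq xt_1yt_2\cdot yx\cdot t_3yt_4x,\qquad (\mathrm{II})\quad xt_1yt_2\cdot xy\cdot t_3xt_4y\bumpeq xt_1yt_2\cdot yx\cdot t_3xt_4y,$$ respectively, by replacing, on both sides, the $i$-th occurrence of $x$ by $x^*$ and the $j$-th occurrence of $y$ by $y^*$ (for $i=0$ no $x$ is replaced, for $j=0$ no $y$ is replaced). The identities $(\mathrm I)_{ij}$, $(\mathrm{II})_{ij}$ for $i,j=0,1,3$, together with $$(\mathrm{III})\quad xt_1x^*t_2x\bumpeq xt_1xt_2x,\qquad(\mathrm{IV})\quad xt_1x^*t_2x^*\bumpeq xt_1xt_2x^*,$$ form a basis for the involutory monoid identities of each of these monoids. A basis of (involutory) semigroup identities is obtained by deleting every possible choice of a subset of the set of letters $\{t_1,t_2,t_3,t_4\}$ in $(\mathrm I)_{ij}$ and $(\mathrm{II})_{ij}$ and every possible choice of a subset of $\{t_1,t_2\}$ in $(\mathrm{III})$ and $(\mathrm{IV})$ (that is, it consists of all identities arising in this way).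
   Context: Involutory semigroups (monoids) are semigroups (monoids) with a unary operation ${}^*$ satisfying $(ab)^*=b^*a^*$ and $(a^* )^*=a$. Identities are pairs of words over $X\cup X^*$ ($X$ a countably infinite set of variables, $X^*=\{x^*:x\in X\}$ a disjoint copy); an identity holds in an involutory semigroup if both sides have equal values under every substitution for the variables, where $x^*$ takes the value of the involution on the value of $x$. A set $\Sigma$ of identities holding in an involutory monoid $\mathcal S$ is a basis for its monoid (respectively semigroup) identities if every identity holding in $\mathcal S$ holds in every involutory monoid (respectively involutory semigroup) satisfying $\Sigma$. An involutory monoid is finitely based if it has a finite basis of involutory semigroup identities. The monoid $\overline{2\mathfrak{Cob}^\circ_1}$ (respectively $2\mathfrak{Cob}^\circ_1$) consists of all pairs $(\alpha,g)$ with $\alpha$ a set partition of $\{1\}\sqcup\{1'\}$ (one incoming vertex $1$, one outgoing vertex $1'$) and $g$ a function from the blocks of $\alpha$ to $\mathbb Z$ (respectively $\mathbb N_0$). Product: $(\alpha,g)(\beta,h)=(\alpha\beta,\mathbf g)$, where the outgoing vertex of $\alpha$ is identified with the incoming vertex of $\beta$ (middle vertex), $(\alpha\cup\beta)^t$ is the partition generated by $\alpha$ and $\beta$ on the three vertices, $\alpha\beta$ is its restriction to the two outer vertices, and the label of a block of $\alpha\beta$ contained in a block $C$ of $(\alpha\cup\beta)^t$, the union of blocks $A_1,\dots,A_a$ of $\alpha$ and $B_1,\dots,B_b$ of $\beta$ and containing $v$ middle vertices, is $\sum_i g(A_i)+\sum_j h(B_j)+v-(a+b)+1$. The involution ${}^\sigma$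 swaps the incoming and the outgoing vertex and carries the labels of blocks along. The monoid $\mathfrak L^\flat_2$ (respectively $\overline{\mathfrak L^\flat_2}$) consists of circle-free planar string diagrams in a rectangle with two incoming points on one side and two outgoing points on the opposite side, up to isotopy, whose regions are labelled by elements of $\mathcal S=\mathbb N_0$ (respectively $\mathcal S=\mathbb Z$). Explicitly, the elements are the rank 2 elements $p|q|r$ with $p,q,r\in\mathcal S$ (two parallel transversal strings; $p,q,r$ are the labels of the three regions in their order, $q$ between the strings) and the rank 0 elements $a)b(c$ with $a,b,c\in\mathcal S$ (one string joining the two incoming points, cutting off a region labelled $a$; one string joining the two outgoing points, cutting off a region labelled $c$; the remaining region is labelled $b$). The product concatenates diagrams, adds the labels of merged regions, and a created circle enclosing total label $x$ contributes $x+1$ to the region containing it: $p|q|r\cdot u|v|w=(p+u)|(q+v)|(r+w)$; $\;p|q|r\cdot a)b(c=(q+a)\,)\,(p+b+r)\,(\,c$; $\;a)b(c\cdot p|q|r=a\,)\,(p+b+r)\,(\,(c+q)$; $\;a)b(c\cdot d)e(f=a\,)\,(b+c+1+d+e)\,(\,f$. The involution ${}^\sigma$ (reflection swapping the incoming and outgoing sides) is $(p|q|r)^\sigma=p|q|r$, $(a)b(c)^\sigma=c)b(a$. In all cases ${}^\sigma$ interprets the unary operation ${}^*$. *)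

theory Defs
  imports "HOL-Algebra.Group" "HOL-Library.Disjoint_Sets"
begin

text \<open>One record serves both signatures; the field \<open>one\<close> is meaningless in an involutory semigroup.\<close>

record 'a involutory = "'a monoid" +
  star :: "'a \<Rightarrow> 'a"

locale involutory_semigroup =
  fixes M :: "('a, 'b) involutory_scheme" (structure)
  assumes mult_closed: "a \<in> carrier M \<Longrightarrow> b \<in> carrier M \<Longrightarrow> a \<otimes> b \<in> carrier M"
    and mult_assoc: "a \<in> carrier M \<Longrightarrow> b \<in> carrier M \<Longrightarrow> c \<in> carrier M \<Longrightarrow>
      (a \<otimes> b) \<otimes> c = a \<otimes> (b \<otimes> c)"
    and star_closed: "a \<in> carrier M \<Longrightarrow> star M a \<in> carrier M"
    and star_mult: "a \<in> carrier M \<Longrightarrow> b \<in> carrier M \<Longrightarrow> star M (a \<otimes> b) = star M b \<otimes> star M a"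
    and star_star: "a \<in> carrier M \<Longrightarrow> star M (star M a) = a"

locale involutory_monoid = monoid M + involutory_semigroup M
  for M :: "('a, 'b) involutory_scheme" (structure)

datatype letter = Var nat | Star nat

type_synonym word = "letter list"
type_synonym identity = "word \<times> word"

fun letter_value :: "('a, 'b) involutory_scheme \<Rightarrow> (nat \<Rightarrow> 'a) \<Rightarrow> letter \<Rightarrow> 'a" where
  "letter_value M \<phi> (Var x) = \<phi> x"
| "letter_value M \<phi> (Star x) = star M (\<phi> x)"

text \<open>The value of a nonempty word does not involve \<open>\<one>\<close>, so it makes sense in a semigroup.\<close>

fun word_value :: "('a, 'b) involutory_scheme \<Rightarrow> (nat \<Rightarrow> 'a) \<Rightarrow> word \<Rightarrow> 'a" where
  "word_value M \<phi> [] = \<one>\<^bsub>M\<^esub>"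
| "word_value M \<phi> [l] = letter_value M \<phi> l"
| "word_value M \<phi> (l # m # w) = letter_value M \<phi> l \<otimes>\<^bsub>M\<^esub> word_value M \<phi> (m # w)"

definition holds_in :: "('a, 'b) involutory_scheme \<Rightarrow> identity \<Rightarrow> bool" where
  "holds_in M p \<longleftrightarrow>
    (\<forall>\<phi>. range \<phi> \<subseteq> carrier M \<longrightarrow> word_value M \<phi> (fst p) = word_value M \<phi> (snd p))"

definition semigroup_identities :: "identity set" where
  "semigroup_identities = {(u, v). u \<noteq> [] \<and> v \<noteq> []}"

text \<open>HOL has no quantifier over types, so the two notions of basis take as parameter the type
  \<open>'m\<close> in which the carriers of the models live. A statement about bases is to be read
  with \<open>'m\<close> universally quantified at the level of the theorem; as identities involve
  only finitely many variables, the instance \<open>'m = nat\<close> implies all others.\<close>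

definition monoid_identity_basis ::
    "'m itself \<Rightarrow> identity set \<Rightarrow> ('a, 'b) involutory_scheme \<Rightarrow> bool" where
  "monoid_identity_basis (_ :: 'm itself) \<Sigma> S \<longleftrightarrow>
    (\<forall>p\<in>\<Sigma>. holds_in S p) \<and>
    (\<forall>p. holds_in S p \<longrightarrow>
      (\<forall>M :: 'm involutory. involutory_monoid M \<and> (\<forall>q\<in>\<Sigma>. holds_in M q) \<longrightarrow> holds_in M p))"

definition semigroup_identity_basis ::
    "'m itself \<Rightarrow> identity set \<Rightarrow> ('a, 'b) involutory_scheme \<Rightarrow> bool" where
  "semigroup_identity_basis (_ :: 'm itself) \<Sigma> S \<longleftrightarrow>
    \<Sigma> \<subseteq> semigroup_identities \<and> (\<forall>p\<in>\<Sigma>. holds_in S p) \<and>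
    (\<forall>p\<in>semigroup_identities. holds_in S p \<longrightarrow>
      (\<forall>M :: 'm involutory. involutory_semigroup M \<and> (\<forall>q\<in>\<Sigma>. holds_in M q) \<longrightarrow> holds_in M p))"

definition finitely_based :: "'m itself \<Rightarrow> ('a, 'b) involutory_scheme \<Rightarrow> bool" where
  "finitely_based T S \<longleftrightarrow> (\<exists>\<Sigma>. finite \<Sigma> \<and> semigroup_identity_basis T \<Sigma> S)"

abbreviation (input) vx :: nat where "vx \<equiv> 0"
abbreviation (input) vt1 :: nat where "vt1 \<equiv> 1"
abbreviation (input) vt2 :: nat where "vt2 \<equiv> 2"
abbreviation (input) vt3 :: nat where "vt3 \<equiv> 3"
abbreviation (input) vt4 :: nat where "vt4 \<equiv> 4"
abbreviation (input) vy :: nat where "vy \<equiv> 5"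

text \<open>Replaces the \<open>i\<close>-th occurrence of \<open>x\<close> by \<open>x\<^sup>*\<close>, counting from \<open>1\<close>. As \<open>0 - 1 = 0\<close> on
  \<^typ>\<open>nat\<close>, nothing is replaced for \<open>i = 0\<close>.\<close>

fun star_occurrence :: "nat \<Rightarrow> nat \<Rightarrow> word \<Rightarrow> word" where
  "star_occurrence i x [] = []"
| "star_occurrence i x (l # w) =
    (if l = Var x then
       (if i = 1 then Star x # w else l # star_occurrence (i - 1) x w)
     else l # star_occurrence i x w)"

definition star_occurrences :: "nat \<Rightarrow> nat \<Rightarrow> identity \<Rightarrow> identity" where
  "star_occurrences i j =
    (let f = (\<lambda>w. star_occurrence i vx (star_occurrence j vy w)) in map_prod f f)"

definition identity_I :: identity where
  "identity_I =
    ([Var vx, Var vt1, Var vy, Var vt2] @ [Var vx, Var vy] @ [Var vt3, Var vy, Var vt4, Var vx],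
     [Var vx, Var vt1, Var vy, Var vt2] @ [Var vy, Var vx] @ [Var vt3, Var vy, Var vt4, Var vx])"

definition identity_II :: identity where
  "identity_II =
    ([Var vx, Var vt1, Var vy, Var vt2] @ [Var vx, Var vy] @ [Var vt3, Var vx, Var vt4, Var vy],
     [Var vx, Var vt1, Var vy, Var vt2] @ [Var vy, Var vx] @ [Var vt3, Var vx, Var vt4, Var vy])"

definition identity_III :: identity where
  "identity_III =
    ([Var vx, Var vt1, Star vx, Var vt2, Var vx],
     [Var vx, Var vt1, Var vx, Var vt2, Var vx])"

definition identity_IV :: identity where
  "identity_IV =
    ([Var vx, Var vt1, Star vx, Var vt2, Star vx],
     [Var vx, Var vt1, Var vx, Var vt2, Star vx])"

definition identities_I_II :: "identity set" where
  "identities_I_II =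
    {star_occurrences i j p | i j p.
      i \<in> {0, 1, 3} \<and> j \<in> {0, 1, 3} \<and> p \<in> {identity_I, identity_II}}"

definition monoid_basis :: "identity set" where
  "monoid_basis = identities_I_II \<union> {identity_III, identity_IV}"

definition delete_letters :: "nat set \<Rightarrow> identity \<Rightarrow> identity" where
  "delete_letters T = (let f = filter (\<lambda>l. l \<notin> Var ` T) in map_prod f f)"

definition semigroup_basis :: "identity set" where
  "semigroup_basis =
    {delete_letters T p | T p. T \<subseteq> {vt1, vt2, vt3, vt4} \<and> p \<in> identities_I_II} \<union>
    {delete_letters T p | T p. T \<subseteq> {vt1, vt2} \<and> p \<in> {identity_III, identity_IV}}"

text \<open>\<open>In\<close> and \<open>Out\<close> stand for \<open>1\<close> and \<open>1'\<close>; \<open>Mid\<close> is the middle vertex used for forming products.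
  The set \<open>L\<close> of labels is \<open>\<nat>\<close> or \<open>UNIV\<close>, as a set of integers. Labellings are extensional
  functions, so that each is determined by its values on the blocks.\<close>

datatype vertex = In | Mid | Out

type_synonym labelled_partition = "vertex set set \<times> (vertex set \<Rightarrow> int)"

definition cob_carrier :: "int set \<Rightarrow> labelled_partition set" where
  "cob_carrier L = {(\<alpha>, g). partition_on {In, Out} \<alpha> \<and> g \<in> \<alpha> \<rightarrow>\<^sub>E L}"

definition to_left :: "vertex \<Rightarrow> vertex" where
  "to_left = id(Out := Mid)"

definition to_right :: "vertex \<Rightarrow> vertex" where
  "to_right = id(In := Mid)"

text \<open>The partition of the three vertices generated by \<open>\<alpha>\<close>, placed on \<open>In\<close> and \<open>Mid\<close>, and \<open>\<beta>\<close>,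
  placed on \<open>Mid\<close> and \<open>Out\<close>.\<close>

definition joint_partition :: "vertex set set \<Rightarrow> vertex set set \<Rightarrow> vertex set set" where
  "joint_partition \<alpha> \<beta> =
    UNIV // ((\<Union>A\<in>\<alpha>. (to_left ` A) \<times> (to_left ` A)) \<union> (\<Union>B\<in>\<beta>. (to_right ` B) \<times> (to_right ` B)))\<^sup>*"

definition outer_partition :: "vertex set set \<Rightarrow> vertex set set" where
  "outer_partition \<gamma> = {C \<inter> {In, Out} | C. C \<in> \<gamma>} - {{}}"

text \<open>The summand \<open>v - (a + b) + 1\<close> is the first Betti number of the component \<open>C\<close>, seen as a connected
  graph with the blocks as nodes and the middle vertices as edges; in particular it is never
  negative. In the product, the component \<open>{Mid}\<close>, if present, is dropped together with its label.\<close>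

definition component_label :: "labelled_partition \<Rightarrow> labelled_partition \<Rightarrow> vertex set \<Rightarrow> int" where
  "component_label = (\<lambda>(\<alpha>, g) (\<beta>, h) C.
    let As = {A \<in> \<alpha>. to_left ` A \<subseteq> C}; Bs = {B \<in> \<beta>. to_right ` B \<subseteq> C}; v = card (C \<inter> {Mid})
    in (\<Sum>A\<in>As. g A) + (\<Sum>B\<in>Bs. h B) + int v - int (card As + card Bs) + 1)"

definition cob_mult :: "labelled_partition \<Rightarrow> labelled_partition \<Rightarrow> labelled_partition" where
  "cob_mult a b =
    (let \<gamma> = joint_partition (fst a) (fst b); \<delta> = outer_partition \<gamma>
     in (\<delta>, \<lambda>D\<in>\<delta>. component_label a b (THE C. C \<in> \<gamma> \<and> D \<subseteq> C)))"

definition swap_vertex :: "vertex \<Rightarrow> vertex" where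
  "swap_vertex = id(In := Out, Out := In)"

definition cob_star :: "labelled_partition \<Rightarrow> labelled_partition" where
  "cob_star = (\<lambda>(\<alpha>, g). let \<alpha>' = (`) swap_vertex ` \<alpha> in (\<alpha>', \<lambda>A\<in>\<alpha>'. g (swap_vertex ` A)))"

definition cob_one :: labelled_partition where
  "cob_one = ({{In, Out}}, \<lambda>A\<in>{{In, Out}}. 0)"

definition Cob1 :: "int set \<Rightarrow> labelled_partition involutory" where
  "Cob1 L = \<lparr>carrier = cob_carrier L, mult = cob_mult, one = cob_one, star = cob_star\<rparr>"

text \<open>\<open>Rank2 p q r\<close> is the diagram \<open>p|q|r\<close>, and \<open>Rank0 a b c\<close> is the diagram \<open>a)b(c\<close>.
  In the product of two diagrams of rank 0, the label \<open>c + d + 1\<close> is the contribution of the created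
  circle, which encloses the total label \<open>c + d\<close>.\<close>

datatype diagram = Rank2 int int int | Rank0 int int int

definition diagram_carrier :: "int set \<Rightarrow> diagram set" where
  "diagram_carrier L =
    {Rank2 p q r | p q r. p \<in> L \<and> q \<in> L \<and> r \<in> L} \<union>
    {Rank0 a b c | a b c. a \<in> L \<and> b \<in> L \<and> c \<in> L}"

fun diagram_mult :: "diagram \<Rightarrow> diagram \<Rightarrow> diagram" where
  "diagram_mult (Rank2 p q r) (Rank2 u v w) = Rank2 (p + u) (q + v) (r + w)"
| "diagram_mult (Rank2 p q r) (Rank0 a b c) = Rank0 (q + a) (p + b + r) c"
| "diagram_mult (Rank0 a b c) (Rank2 p q r) = Rank0 a (p + b + r) (c + q)"
| "diagram_mult (Rank0 a b c) (Rank0 d e f) = Rank0 a (b + c + 1 + d + e) f"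

fun diagram_star :: "diagram \<Rightarrow> diagram" where
  "diagram_star (Rank2 p q r) = Rank2 p q r"
| "diagram_star (Rank0 a b c) = Rank0 c b a"

definition L2 :: "int set \<Rightarrow> diagram involutory" where
  "L2 L = \<lparr>carrier = diagram_carrier L, mult = diagram_mult, one = Rank2 0 0 0,
    star = diagram_star\<rparr>"

end

theory Submission imports Defs begin

text \<open>
  Call an occurrence of a variable in a word a middle occurrence if the same variable occurs (with
  or without star) both earlier and later in the word. The identities (III) and (IV) say that a
  middle occurrence may gain or lose its star; (I) and (II), in all their starred forms, say that
  two adjacent middle occurrences of different variables commute. Let a middle step
  (\<open>middle_step\<close>) be one such change. Everything follows from the fact that, for
  each of the four monoids, the identities that hold are precisely the pairs of words connected by
  middle steps.

  Middle steps hold in the diagram monoids (\<open>middle_step_L2\<close>). If a diagram of rank 0 is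
  substituted for the changed letter, then it stands between two other diagrams of rank 0, and all
  regions it contributes end up in the one middle region, so that only the sum of its labels
  matters, a commutative and \<open>\<sigma>\<close>-invariant quantity. The cobordism monoid is the image of
  the diagram monoid under the homomorphism \<open>cob_of\<close>, which forgets labels, so it
  satisfies all identities of the diagram monoid.

  Conversely, an identity \<open>u \<approx> v\<close> of the cobordism monoid forces \<open>u\<close> and \<open>v\<close> to
  have the same profile: each variable occurs equally often in both words, and for all \<open>x\<close> and \<open>y\<close>
  the first (last) occurrence of \<open>y\<close> carries the same star and is preceded (followed) by the same
  number of occurrences of \<open>x\<close>. This is read off from an evaluation that sends \<open>y\<close> to a
  rank 0 element and everything else to rank 2 (\<open>profile_eq_if_holds\<close>). The profile fixes the
  arrangement of all first and last occurrences and, for every gap between consecutive ones, how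
  many middle occurrences of each variable lie in it. Within a gap all order and
  all stars can be adjusted by middle steps, so words with equal profiles are connected
  (\<open>middle_steps_after_prefix\<close>).

  Finally, every identity in the two bases is a middle step, and every middle step is
  a consequence of the semigroup basis (\<open>middle_step_value\<close>): a variable \<open>t\<^sub>i\<close> stands
  for the factor between two letters, and it has to be deleted if that factor is
  empty, which is why the deleted forms belong to the semigroup basis. In monoids they follow by
  substituting \<open>\<one>\<close>.
\<close>

section \<open>Words and the rewriting of middle letters\<close>

fun var_of :: "letter \<Rightarrow> nat" where
  "var_of (Var x) = x"
| "var_of (Star x) = x"

fun flip :: "letter \<Rightarrow> letter" where
  "flip (Var x) = Star x"
| "flip (Star x) = Var x"

definition vars :: "word \<Rightarrow> nat set" where
  "vars w = var_of ` set w"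

lemma vars_simps [simp]:
  "vars [] = {}" "vars (l # w) = insert (var_of l) (vars w)" "vars (u @ v) = vars u \<union> vars v"
  by (auto simp: vars_def)

lemma var_of_flip [simp]: "var_of (flip l) = var_of l"
  by (cases l) auto

lemma flip_flip [simp]: "flip (flip l) = l"
  by (cases l) auto

lemma same_var_of: "var_of l = var_of m \<longleftrightarrow> l = m \<or> l = flip m"
  by (cases l; cases m) auto

lemma split_at_var:
  assumes "x \<in> vars w"
  obtains u l v where "w = u @ l # v" "var_of l = x"
  using assms unfolding vars_def by (metis image_iff in_set_conv_decomp)

lemma split_at_two_vars:
  assumes "x \<in> vars w" "y \<in> vars w" "x \<noteq> y"
  obtains (xy) u l v m r where "w = u @ l # v @ m # r" "var_of l = x" "var_of m = y"
    | (yx) u l v m r where "w = u @ m # v @ l # r" "var_of l = x" "var_of m = y"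
proof -
  obtain u l v where w: "w = u @ l # v" and l: "var_of l = x"
    using assms(1) by (rule split_at_var)
  consider "y \<in> vars u" | "y \<in> vars v"
    using assms l w by auto
  then show thesis
  proof cases
    case 1
    then obtain a m b where "u = a @ m # b" "var_of m = y" by (rule split_at_var)
    with w l show ?thesis by (intro yx[of a m b l v]) auto
  next
    case 2
    then obtain a m b where "v = a @ m # b" "var_of m = y" by (rule split_at_var)
    with w l show ?thesis by (intro xy[of u l a m b]) auto
  qed
qed

text \<open>Only different variables are swapped: two adjacent middle letters with the same variable differ at
  most in their stars, and restarring both interchanges them.\<close>

inductive middle_step :: "word \<Rightarrow> word \<Rightarrow> bool" where
  swap: "var_of l \<noteq> var_of m \<Longrightarrow> {var_of l, var_of m} \<subseteq> vars u \<inter> vars v \<Longrightarrow>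
    middle_step (u @ l # m # v) (u @ m # l # v)"
| restar: "var_of l = var_of m \<Longrightarrow> var_of l \<in> vars u \<inter> vars v \<Longrightarrow>
    middle_step (u @ l # v) (u @ m # v)"

lemma middle_step_nonempty:
  "middle_step u v \<Longrightarrow> u \<noteq> [] \<and> v \<noteq> []"
  by (auto elim: middle_step.cases)

abbreviation occs :: "nat \<Rightarrow> word \<Rightarrow> word" where
  "occs x \<equiv> filter (\<lambda>l. var_of l = x)"

definition before :: "nat \<Rightarrow> word \<Rightarrow> word" where
  "before y w = takeWhile (\<lambda>l. var_of l \<noteq> y) w"

definition after :: "nat \<Rightarrow> word \<Rightarrow> word" where
  "after y w = rev (before y (rev w))"

text \<open>If \<open>y\<close> does not occur, then the prefix and the suffix are the whole word, so that the entry
  contains no more than the number of occurrences of \<open>x\<close>.\<close>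

definition profile :: "word \<Rightarrow> nat \<Rightarrow> nat \<Rightarrow> nat \<times> nat \<times> nat \<times> (letter \<times> letter) option" where
  "profile w = (\<lambda>x y. (length (occs x w), length (occs x (before y w)), length (occs x (after y w)),
     if y \<in> vars w then Some (hd (occs y w), last (occs y w)) else None))"

lemma occs_eq_Nil_iff [simp]: "occs x w = [] \<longleftrightarrow> x \<notin> vars w"
  by (auto simp: filter_empty_conv vars_def)

lemma occs_absent [simp]: "x \<notin> vars w \<Longrightarrow> occs x w = []"
  by simp

lemma before_simps [simp]:
  "before y [] = []"
  "before y (l # w) = (if var_of l = y then [] else l # before y w)"
  by (auto simp: before_def)

lemma before_append: "before y (u @ v) = (if y \<in> vars u then before y u else u @ before y v)"
  by (induction u) auto

lemma vars_rev [simp]: "vars (rev w) = vars w"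
  by (simp add: vars_def)

lemma after_append: "after y (u @ v) = (if y \<in> vars v then after y v else after y u @ v)"
  by (simp add: after_def before_append)

lemma after_simps [simp]:
  "after y [] = []"
  "after y (l # w) = (if y \<in> vars w then after y w else if var_of l = y then w else l # w)"
  using after_append[of y "[l]" w] by (auto simp: after_def)

lemma length_occs_after_le: "length (occs x (after y w)) \<le> length (occs x w)"
  by (induction w) auto

lemma profile_vars:
  assumes "profile u = profile v"
  shows "vars u = vars v"
proof -
  have "length (occs x u) = length (occs x v)" for x
    using fun_cong[OF fun_cong[OF assms, of x], of x] by (simp add: profile_def)
  then have "x \<in> vars u \<longleftrightarrow> x \<in> vars v" for x
    by (metis length_0_conv occs_eq_Nil_iff)
  then show ?thesis by blast
qed

lemma profile_eqD:
  assumes "profile u = profile v"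
  shows "length (occs x u) = length (occs x v)"
    and "length (occs x (before y u)) = length (occs x (before y v))"
    and "length (occs x (after y u)) = length (occs x (after y v))"
    and "y \<in> vars u \<Longrightarrow> hd (occs y u) = hd (occs y v)"
    and "y \<in> vars u \<Longrightarrow> last (occs y u) = last (occs y v)"
  using fun_cong[OF fun_cong[OF assms, of x], of y] profile_vars[OF assms]
  by (auto simp: profile_def split: if_splits)


section \<open>Evaluating words over diagrams\<close>

lemma L2_simps [simp]:
  "mult (L2 L) = diagram_mult" "one (L2 L) = Rank2 0 0 0" "star (L2 L) = diagram_star"
  "carrier (L2 L) = diagram_carrier L"
  by (simp_all add: L2_def)

lemma diagram_mult_assoc:
  "diagram_mult (diagram_mult a b) c = diagram_mult a (diagram_mult b c)"
  by (cases a; cases b; cases c) auto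

lemma diagram_mult_one [simp]:
  "diagram_mult (Rank2 0 0 0) a = a" "diagram_mult a (Rank2 0 0 0) = a"
  by (cases a; simp)+

lemma L2_word_value_Cons [simp]:
  "word_value (L2 L) \<psi> (l # w) = diagram_mult (letter_value (L2 L) \<psi> l) (word_value (L2 L) \<psi> w)"
  by (cases w) auto

lemma L2_word_value_append:
  "word_value (L2 L) \<psi> (u @ v) = diagram_mult (word_value (L2 L) \<psi> u) (word_value (L2 L) \<psi> v)"
  by (induction u) (auto simp: diagram_mult_assoc)

fun is_Rank0 :: "diagram \<Rightarrow> bool" where
  "is_Rank0 (Rank2 p q r) = False"
| "is_Rank0 (Rank0 a b c) = True"

lemma is_Rank0_mult [simp]: "is_Rank0 (diagram_mult a b) \<longleftrightarrow> is_Rank0 a \<or> is_Rank0 b"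
  by (cases a; cases b) auto

lemma is_Rank0_letter_value [simp]: "is_Rank0 (letter_value (L2 L) \<psi> l) \<longleftrightarrow> is_Rank0 (\<psi> (var_of l))"
  by (cases l; cases "\<psi> (var_of l)") auto

lemma is_Rank0_word_value: "is_Rank0 (word_value (L2 L) \<psi> w) \<longleftrightarrow> (\<exists>x\<in>vars w. is_Rank0 (\<psi> x))"
  by (induction w) auto

text \<open>What a diagram adds to the label of the middle region when it is inserted between two diagrams of
  rank 0. All its regions are absorbed, and one of rank 0 creates one more circle, which accounts
  for the summand 1.\<close>

fun total_label :: "diagram \<Rightarrow> int" where
  "total_label (Rank2 p q r) = p + q + r"
| "total_label (Rank0 a b c) = a + b + c + 1"

lemma total_label_mult [simp]: "total_label (diagram_mult a b) = total_label a + total_label b"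
  by (cases a; cases b) auto

lemma total_label_star [simp]: "total_label (diagram_star a) = total_label a"
  by (cases a) auto

lemma sandwich_total_label:
  assumes "is_Rank0 a" "is_Rank0 b" "total_label d = total_label e"
  shows "diagram_mult a (diagram_mult d b) = diagram_mult a (diagram_mult e b)"
  using assms by (cases a; cases b; cases d; cases e) auto

lemma Rank2_commute:
  "\<not> is_Rank0 d \<Longrightarrow> \<not> is_Rank0 e \<Longrightarrow> diagram_mult d e = diagram_mult e d"
  by (cases d; cases e) auto

text \<open>Either all changed letters have rank 2, where the monoid is commutative and \<open>\<sigma>\<close> is trivial, or
  one has rank 0, and then so do the earlier and the later occurrence of its variable, whence the
  change takes place between two factors of rank 0.\<close>

lemma middle_step_L2:
  assumes "middle_step u v"
  shows "word_value (L2 L) \<psi> u = word_value (L2 L) \<psi> v"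
  using assms
proof cases
  case (swap l m a b)
  let ?v = "word_value (L2 L) \<psi>" and ?l = "letter_value (L2 L) \<psi>"
  have "diagram_mult (?v a) (diagram_mult (diagram_mult (?l l) (?l m)) (?v b)) =
        diagram_mult (?v a) (diagram_mult (diagram_mult (?l m) (?l l)) (?v b))"
  proof (cases "is_Rank0 (?l l) \<or> is_Rank0 (?l m)")
    case True
    then have "is_Rank0 (?v a)" "is_Rank0 (?v b)"
      using swap by (auto simp: is_Rank0_word_value)
    then show ?thesis by (rule sandwich_total_label) simp
  next
    case False
    then show ?thesis by (simp add: Rank2_commute[of "?l l" "?l m"])
  qed
  then show ?thesis by (simp add: swap L2_word_value_append diagram_mult_assoc)
next
  case (restar l m a b)
  let ?v = "word_value (L2 L) \<psi>" and ?l = "letter_value (L2 L) \<psi>"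
  obtain x where x: "l = Var x \<or> l = Star x" "m = Var x \<or> m = Star x"
    using restar(3) by (cases l; cases m) auto
  have "diagram_mult (?v a) (diagram_mult (?l l) (?v b)) =
        diagram_mult (?v a) (diagram_mult (?l m) (?v b))"
  proof (cases "is_Rank0 (?l l)")
    case True
    then have "is_Rank0 (?v a)" "is_Rank0 (?v b)"
      using restar by (auto simp: is_Rank0_word_value)
    then show ?thesis by (rule sandwich_total_label) (use x in auto)
  next
    case False
    then have "?l l = ?l m"
      using x by (cases "\<psi> x") auto
    then show ?thesis by simp
  qed
  then show ?thesis by (simp add: restar L2_word_value_append)
qed

section \<open>The cobordism monoid as an image of the diagram monoid\<close>

definition through_block :: "int \<Rightarrow> labelled_partition" where
  "through_block q = ({{In, Out}}, \<lambda>A\<in>{{In, Out}}. q)"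

definition two_blocks :: "int \<Rightarrow> int \<Rightarrow> labelled_partition" where
  "two_blocks a c = ({{In}, {Out}}, \<lambda>A\<in>{{In}, {Out}}. if A = {In} then a else c)"

text \<open>A transversal block corresponds to the region between the two parallel strings; blocks \<open>{1}\<close> and
  \<open>{1'}\<close> correspond to the regions cut off at the incoming and the outgoing side.\<close>

fun cob_of :: "diagram \<Rightarrow> labelled_partition" where
  "cob_of (Rank2 p q r) = through_block q"
| "cob_of (Rank0 a b c) = two_blocks a c"

lemma through_block_eq_iff [simp]: "through_block p = through_block q \<longleftrightarrow> p = q"
  by (auto simp: through_block_def dest: fun_cong[where x = "{In, Out}"])

lemma doubleton_eq_iff_simps [simp]:
  "{In} \<noteq> {Out}" "{Out} \<noteq> {In}" "{In, Out} \<noteq> {In}" "{In, Out} \<noteq> {Out}" 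
  "{In} \<noteq> {In, Out}" "{Out} \<noteq> {In, Out}" 
  by blast+

lemma two_blocks_eq_iff [simp]: "two_blocks a c = two_blocks a' c' \<longleftrightarrow> a = a' \<and> c = c'"
  by (auto simp: two_blocks_def dest: fun_cong[where x = "{In}"] fun_cong[where x = "{Out}"])

lemma through_block_neq_two_blocks [simp]:
  "through_block q \<noteq> two_blocks a c" "two_blocks a c \<noteq> through_block q"
proof -
  have "{In, Out} \<in> fst (through_block q)" "{In, Out} \<notin> fst (two_blocks a c)"
    by (simp_all add: through_block_def two_blocks_def)
  then show "through_block q \<noteq> two_blocks a c" "two_blocks a c \<noteq> through_block q"
    by metis+
qed

lemma UNIV_vertex: "(UNIV :: vertex set) = {In, Mid, Out}"
  using vertex.exhaust by auto

text \<open>Describing the generated equivalence as the kernel of a function avoids any calculation with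
  transitive closures beyond finding paths between vertices of the same component.\<close>

lemma joint_partition_eq:
  fixes f :: "vertex \<Rightarrow> 'c"
  defines "U \<equiv> \<lambda>\<alpha> \<beta>. (\<Union>A\<in>\<alpha>. (to_left ` A) \<times> (to_left ` A)) \<union> (\<Union>B\<in>\<beta>. (to_right ` B) \<times> (to_right ` B))"
  assumes "\<And>x y. (x, y) \<in> U \<alpha> \<beta> \<Longrightarrow> f x = f y"
    and "\<And>x y. f x = f y \<Longrightarrow> (x, y) \<in> (U \<alpha> \<beta>)\<^sup>*"
  shows "joint_partition \<alpha> \<beta> = (\<lambda>x. {y. f x = f y}) ` {In, Mid, Out}"
proof -
  have "f x = f y" if "(x, y) \<in> (U \<alpha> \<beta>)\<^sup>*" for x y
    using that by (induction rule: rtrancl_induct) (use assms(2) in auto)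
  then have "(U \<alpha> \<beta>)\<^sup>* = {(x, y). f x = f y}"
    using assms(3) by (intro Set.set_eqI) blast
  then have "joint_partition \<alpha> \<beta> = UNIV // {(x, y). f x = f y}"
    by (simp add: joint_partition_def U_def)
  also have "\<dots> = (\<lambda>x. {(x, y). f x = f y} `` {x}) ` UNIV"
    unfolding quotient_def by blast
  also have "\<dots> = (\<lambda>x. {y. f x = f y}) ` {In, Mid, Out}"
    unfolding UNIV_vertex[symmetric] by (intro image_cong) auto
  finally show ?thesis .
qed

lemma placement_simps [simp]:
  "to_left In = In" "to_left Out = Mid" "to_right In = Mid" "to_right Out = Out"
  by (simp_all add: to_left_def to_right_def)

lemma Collect_eq_vertex:
  "{y. P y} = (if P In then {In} else {}) \<union> (if P Mid then {Mid} else {}) \<union> (if P Out then {Out} else {})"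
  for P :: "vertex \<Rightarrow> bool"
proof (rule Set.set_eqI)
  fix y show "y \<in> {y. P y} \<longleftrightarrow>
    y \<in> (if P In then {In} else {}) \<union> (if P Mid then {Mid} else {}) \<union> (if P Out then {Out} else {})"
    by (cases y) simp_all
qed

lemma joint_partition_simps [simp]:
  "joint_partition {{In, Out}} {{In, Out}} = {{In, Mid, Out}}"
  "joint_partition {{In, Out}} {{In}, {Out}} = {{In, Mid}, {Out}}"
  "joint_partition {{In}, {Out}} {{In, Out}} = {{In}, {Mid, Out}}"
  "joint_partition {{In}, {Out}} {{In}, {Out}} = {{In}, {Mid}, {Out}}"
proof -
  show "joint_partition {{In, Out}} {{In, Out}} = {{In, Mid, Out}}"
  proof (subst joint_partition_eq[where f = "\<lambda>_. ()"])
    \<comment> \<open>Any two vertices are connected through the middle vertex.\<close>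
    let ?r = "(\<Union>A\<in>{{In, Out}}. to_left ` A \<times> to_left ` A) \<union> (\<Union>B\<in>{{In, Out}}. to_right ` B \<times> to_right ` B)"
    fix x y :: vertex
    have "(z, Mid) \<in> ?r" "(Mid, z) \<in> ?r" for z by (cases z; simp)+
    then show "(x, y) \<in> ?r\<^sup>*" by (meson r_into_rtrancl rtrancl_trans)
  qed (simp_all add: UNIV_vertex)
  show "joint_partition {{In, Out}} {{In}, {Out}} = {{In, Mid}, {Out}}"
  proof (subst joint_partition_eq[where f = "\<lambda>x. x = Out"])
    fix x y :: vertex
    assume "(x = Out) = (y = Out)"
    then show "(x, y) \<in> ((\<Union>A\<in>{{In, Out}}. to_left ` A \<times> to_left ` A) \<union>
      (\<Union>B\<in>{{In}, {Out}}. to_right ` B \<times> to_right ` B))\<^sup>*"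
      by (intro r_into_rtrancl) (cases x; cases y; simp)
  qed (auto simp: Collect_eq_vertex)
  show "joint_partition {{In}, {Out}} {{In, Out}} = {{In}, {Mid, Out}}"
  proof (subst joint_partition_eq[where f = "\<lambda>x. x = In"])
    fix x y :: vertex
    assume "(x = In) = (y = In)"
    then show "(x, y) \<in> ((\<Union>A\<in>{{In}, {Out}}. to_left ` A \<times> to_left ` A) \<union>
      (\<Union>B\<in>{{In, Out}}. to_right ` B \<times> to_right ` B))\<^sup>*"
      by (intro r_into_rtrancl) (cases x; cases y; simp)
  qed (auto simp: Collect_eq_vertex)
  show "joint_partition {{In}, {Out}} {{In}, {Out}} = {{In}, {Mid}, {Out}}"
  proof (subst joint_partition_eq[where f = "\<lambda>x. x"])
    fix x y :: vertex
    assume "x = y"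
    then show "(x, y) \<in> ((\<Union>A\<in>{{In}, {Out}}. to_left ` A \<times> to_left ` A) \<union>
      (\<Union>B\<in>{{In}, {Out}}. to_right ` B \<times> to_right ` B))\<^sup>*"
      by simp
  qed (auto simp: Collect_eq_vertex)
qed

lemma outer_partition_simps [simp]:
  "outer_partition {} = {}"
  "outer_partition (insert C \<gamma>) =
    (if C \<inter> {In, Out} = {} then outer_partition \<gamma> else insert (C \<inter> {In, Out}) (outer_partition \<gamma>))"
  by (auto simp: outer_partition_def)

text \<open>Eliminates the definite description in the product: for each outer block it suffices to exhibit the
  component that contains it.\<close>

lemma cob_mult_eqI:
  assumes "joint_partition (fst a) (fst b) = \<gamma>" "outer_partition \<gamma> = \<delta>"
    and "\<And>D. D \<in> \<delta> \<Longrightarrow> \<exists>C\<in>\<gamma>. (\<forall>C'\<in>\<gamma>. D \<subseteq> C' \<longleftrightarrow> C' = C) \<and> component_label a b C = h D"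
  shows "cob_mult a b = (\<delta>, restrict h \<delta>)"
proof -
  have "component_label a b (THE C. C \<in> \<gamma> \<and> D \<subseteq> C) = h D" if D: "D \<in> \<delta>" for D
  proof -
    obtain C where C: "C \<in> \<gamma>" "\<forall>C'\<in>\<gamma>. D \<subseteq> C' \<longleftrightarrow> C' = C" "component_label a b C = h D"
      using assms(3)[OF D] by blast
    then have "(THE C. C \<in> \<gamma> \<and> D \<subseteq> C) = C" by (intro the_equality) auto
    with C(3) show ?thesis by simp
  qed
  then show ?thesis
    by (auto simp: cob_mult_def assms(1,2) Let_def intro!: restrict_ext)
qed

lemma Collect_mem_pair:
  "{A. (A = a \<or> A = b) \<and> P A} = (if P a then {a} else {}) \<union> (if P b then {b} else {})"
  by auto

lemma component_label_simps:
  "component_label (through_block p) (through_block q) {In, Mid, Out} = p + q"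
  "component_label (through_block p) (two_blocks a c) {In, Mid} = p + a"
  "component_label (through_block p) (two_blocks a c) {Out} = c"
  "component_label (two_blocks a c) (through_block p) {In} = a"
  "component_label (two_blocks a c) (through_block p) {Mid, Out} = c + p"
  "component_label (two_blocks a c) (two_blocks a' c') {In} = a"
  "component_label (two_blocks a c) (two_blocks a' c') {Out} = c'"
  by (simp_all add: component_label_def through_block_def two_blocks_def Let_def
      Collect_conv_if Collect_mem_pair)

lemma cob_mult_simps:
  "cob_mult (through_block p) (through_block q) = through_block (p + q)"
  "cob_mult (through_block p) (two_blocks a c) = two_blocks (p + a) c"
  "cob_mult (two_blocks a c) (through_block p) = two_blocks a (c + p)"
  "cob_mult (two_blocks a c) (two_blocks a' c') = two_blocks a c'"
proof -
  have blocks: "fst (through_block q) = {{In, Out}}" "fst (two_blocks a c) = {{In}, {Out}}" for q a c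
    by (simp_all add: through_block_def two_blocks_def)
  show "cob_mult (through_block p) (through_block q) = through_block (p + q)"
    unfolding through_block_def[of "p + q"]
    by (rule cob_mult_eqI[where \<gamma> = "{{In, Mid, Out}}"]) (simp_all add: blocks component_label_simps)
  show "cob_mult (through_block p) (two_blocks a c) = two_blocks (p + a) c"
    unfolding two_blocks_def[of "p + a"]
    by (rule cob_mult_eqI[where \<gamma> = "{{In, Mid}, {Out}}"]) (auto simp: blocks component_label_simps)
  show "cob_mult (two_blocks a c) (through_block p) = two_blocks a (c + p)"
    unfolding two_blocks_def[of a "c + p"]
    by (rule cob_mult_eqI[where \<gamma> = "{{In}, {Mid, Out}}"]) (auto simp: blocks component_label_simps)
  show "cob_mult (two_blocks a c) (two_blocks a' c') = two_blocks a c'"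
    unfolding two_blocks_def[of a c']
    by (rule cob_mult_eqI[where \<gamma> = "{{In}, {Mid}, {Out}}"]) (auto simp: blocks component_label_simps)
qed

lemma cob_star_simps:
  "cob_star (through_block p) = through_block p"
  "cob_star (two_blocks a c) = two_blocks c a"
  unfolding cob_star_def through_block_def two_blocks_def
  by (auto simp: swap_vertex_def insert_commute Let_def intro!: restrict_ext)

lemma cob_of_mult: "cob_of (diagram_mult d e) = cob_mult (cob_of d) (cob_of e)"
  by (cases d; cases e) (simp_all add: cob_mult_simps)

lemma cob_of_star: "cob_of (diagram_star d) = cob_star (cob_of d)"
  by (cases d) (simp_all add: cob_star_simps)

lemma cob_of_word_value:
  "cob_of (word_value (L2 L) \<psi> w) = word_value (Cob1 L') (\<lambda>x. cob_of (\<psi> x)) w"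
proof -
  have letter: "cob_of (letter_value (L2 L) \<psi> l) = letter_value (Cob1 L') (\<lambda>x. cob_of (\<psi> x)) l" for l
    by (cases l) (simp_all add: Cob1_def cob_of_star)
  have mult: "x \<otimes>\<^bsub>Cob1 L'\<^esub> y = cob_mult x y" for x y
    by (simp add: Cob1_def)
  show ?thesis
  proof (induction w)
    case Nil
    then show ?case by (simp add: Cob1_def cob_one_def through_block_def)
  next
    case (Cons l w)
    then show ?case
      by (cases w) (simp_all add: cob_of_mult letter mult)
  qed
qed

lemma partition_on_In_Out:
  "partition_on {In, Out} \<alpha> \<longleftrightarrow> \<alpha> = {{In, Out}} \<or> \<alpha> = {{In}, {Out}}"
proof
  assume p: "partition_on {In, Out} \<alpha>"
  have sub: "A = {In} \<or> A = {Out} \<or> A = {In, Out}" if "A \<in> \<alpha>" for A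
  proof -
    have "A \<subseteq> {In, Out}" "A \<noteq> {}"
      using that partition_onD1[OF p] partition_onD3[OF p] by auto
    then show ?thesis by (cases "In \<in> A"; cases "Out \<in> A") auto
  qed
  obtain A B where AB: "A \<in> \<alpha>" "In \<in> A" "B \<in> \<alpha>" "Out \<in> B"
    using partition_onD1[OF p] by blast
  have disj: "C \<inter> D = {}" if "C \<in> \<alpha>" "D \<in> \<alpha>" "C \<noteq> D" for C D
    using partition_onD2[OF p] that by (auto simp: disjoint_def)
  have "\<alpha> = {A, B}"
  proof (intro subset_antisym subsetI)
    fix C assume "C \<in> \<alpha>"
    then show "C \<in> {A, B}"
      using sub[of C] disj[of C A] disj[of C B] AB by blast
  qed (use AB in auto)
  then show "\<alpha> = {{In, Out}} \<or> \<alpha> = {{In}, {Out}}"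
    using sub[OF AB(1)] sub[OF AB(3)] AB(2,4) disj[OF AB(1,3)] by auto
qed (auto simp: partition_on_def disjoint_def)

lemma cob_of_onto:
  assumes "0 \<in> L"
  shows "cob_of ` diagram_carrier L = cob_carrier L"
proof (intro subset_antisym subsetI)
  fix a assume "a \<in> cob_of ` diagram_carrier L"
  then show "a \<in> cob_carrier L"
    by (auto simp: diagram_carrier_def cob_carrier_def partition_on_In_Out
        through_block_def two_blocks_def)
next
  fix a assume "a \<in> cob_carrier L"
  then obtain \<alpha> g where a: "a = (\<alpha>, g)" and \<alpha>: "\<alpha> = {{In, Out}} \<or> \<alpha> = {{In}, {Out}}"
    and g: "g \<in> \<alpha> \<rightarrow>\<^sub>E L"
    by (auto simp: cob_carrier_def partition_on_In_Out)
  have "g = restrict g \<alpha>"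
    using g by (metis PiE_restrict)
  from \<alpha> show "a \<in> cob_of ` diagram_carrier L"
  proof
    assume \<alpha>: "\<alpha> = {{In, Out}}"
    have "restrict g \<alpha> = (\<lambda>A\<in>\<alpha>. g {In, Out})"
      by (rule restrict_ext) (simp add: \<alpha>)
    then have "a = cob_of (Rank2 0 (g {In, Out}) 0)"
      using \<open>g = restrict g \<alpha>\<close> by (simp add: a \<alpha> through_block_def)
    moreover have "Rank2 0 (g {In, Out}) 0 \<in> diagram_carrier L"
      using assms g \<alpha> by (auto simp: diagram_carrier_def)
    ultimately show ?thesis by blast
  next
    assume \<alpha>: "\<alpha> = {{In}, {Out}}"
    have "restrict g \<alpha> = (\<lambda>A\<in>\<alpha>. if A = {In} then g {In} else g {Out})"
      by (rule restrict_ext) (auto simp: \<alpha>)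
    then have "a = cob_of (Rank0 (g {In}) 0 (g {Out}))"
      using \<open>g = restrict g \<alpha>\<close> by (simp add: a \<alpha> two_blocks_def)
    moreover have "Rank0 (g {In}) 0 (g {Out}) \<in> diagram_carrier L"
      using assms g \<alpha> by (auto simp: diagram_carrier_def)
    ultimately show ?thesis by blast
  qed
qed

lemma holds_in_Cob1_iff:
  assumes "0 \<in> L"
  shows "holds_in (Cob1 L) p \<longleftrightarrow>
    (\<forall>\<psi>. range \<psi> \<subseteq> diagram_carrier L \<longrightarrow>
      cob_of (word_value (L2 L) \<psi> (fst p)) = cob_of (word_value (L2 L) \<psi> (snd p)))"
    (is "_ \<longleftrightarrow> ?rhs")
proof
  have carrier: "carrier (Cob1 L) = cob_carrier L"
    by (simp add: Cob1_def)
  show ?rhs if holds: "holds_in (Cob1 L) p"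
  proof (intro allI impI)
    fix \<psi> :: "nat \<Rightarrow> diagram" assume "range \<psi> \<subseteq> diagram_carrier L"
    then have "range (\<lambda>x. cob_of (\<psi> x)) \<subseteq> carrier (Cob1 L)"
      unfolding carrier cob_of_onto[OF assms, symmetric] by blast
    then show "cob_of (word_value (L2 L) \<psi> (fst p)) = cob_of (word_value (L2 L) \<psi> (snd p))"
      using holds by (simp add: holds_in_def cob_of_word_value[where L' = L])
  qed
  show "holds_in (Cob1 L) p" if rhs: ?rhs
    unfolding holds_in_def
  proof (intro allI impI)
    fix \<phi> :: "nat \<Rightarrow> labelled_partition" assume "range \<phi> \<subseteq> carrier (Cob1 L)"
    then have "\<exists>d\<in>diagram_carrier L. \<phi> x = cob_of d" for x
      unfolding carrier cob_of_onto[OF assms, symmetric] by blast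
    then obtain \<psi> where \<psi>: "\<And>x. \<psi> x \<in> diagram_carrier L" "\<And>x. \<phi> x = cob_of (\<psi> x)"
      by metis
    from \<psi>(2) have \<phi>: "\<phi> = (\<lambda>x. cob_of (\<psi> x))"
      by (intro ext)
    from \<psi>(1) have "range \<psi> \<subseteq> diagram_carrier L"
      by (rule image_subsetI)
    with rhs have "cob_of (word_value (L2 L) \<psi> (fst p)) = cob_of (word_value (L2 L) \<psi> (snd p))"
      by simp
    then show "word_value (Cob1 L) \<phi> (fst p) = word_value (Cob1 L) \<phi> (snd p)"
      by (simp only: \<phi> cob_of_word_value[where L' = L])
  qed
qed

section \<open>The profile is determined by the identities\<close>

text \<open>With \<open>y\<close> sent to rank 0, the outer labels of the value of a word see only the letters before the
  first and after the last occurrence of \<open>y\<close>, where the occurrences of \<open>x\<close> are counted. The parameter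
  \<open>k\<close> makes the value of \<open>y\<close> asymmetric, so that \<open>k = 1\<close> shows the stars of these two occurrences
  of \<open>y\<close> once the counts are known from \<open>k = 0\<close>.\<close>

definition probe :: "nat \<Rightarrow> nat \<Rightarrow> int \<Rightarrow> nat \<Rightarrow> diagram" where
  "probe x y k = (\<lambda>z. if z = y then Rank0 k 0 0 else Rank2 0 (of_bool (z = x)) 0)"

definition counter :: "nat \<Rightarrow> nat \<Rightarrow> diagram" where
  "counter x = (\<lambda>z. Rank2 0 (of_bool (z = x)) 0)"

lemma counter_value:
  "word_value (L2 L) (counter x) w = Rank2 0 (int (length (occs x w))) 0"
proof (induction w)
  case (Cons l w)
  then show ?case by (cases l) (auto simp: counter_def)
qed auto

lemma probe_value_absent:
  "y \<notin> vars w \<Longrightarrow> word_value (L2 L) (probe x y k) w = Rank2 0 (int (length (occs x w))) 0"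
proof (induction w)
  case (Cons l w)
  then show ?case by (cases l) (auto simp: probe_def)
qed auto

lemma probe_value:
  assumes "y \<in> vars w"
  shows "\<exists>b. word_value (L2 L) (probe x y k) w =
    Rank0 (int (length (occs x (before y w))) + (if hd (occs y w) = Var y then k else 0)) b
          (int (length (occs x (after y w))) + (if last (occs y w) = Var y then 0 else k))"
  using assms
proof (induction w)
  case (Cons l w)
  show ?case
  proof (cases "y \<in> vars w")
    case True
    then obtain b where "word_value (L2 L) (probe x y k) w =
      Rank0 (int (length (occs x (before y w))) + (if hd (occs y w) = Var y then k else 0)) b
          (int (length (occs x (after y w))) + (if last (occs y w) = Var y then 0 else k))"
      using Cons.IH by blast
    then show ?thesis
      using True by (cases l) (auto simp: probe_def)
  next
    case False
    then show ?thesis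
      using Cons.prems by (cases l) (auto simp: probe_value_absent, auto simp: probe_def)
  qed
qed auto

lemma occ_letter_eqI:
  "var_of l = y \<Longrightarrow> var_of m = y \<Longrightarrow> (l = Var y \<longleftrightarrow> m = Var y) \<Longrightarrow> l = m"
  by (cases l; cases m) auto

lemma profile_eq_if_holds:
  assumes holds: "holds_in (Cob1 L) (u, v)" and L: "0 \<in> L" "1 \<in> L"
  shows "profile u = profile v"
proof (intro ext)
  fix x y
  let ?v = "word_value (L2 L)"
  have eq: "cob_of (?v \<psi> u) = cob_of (?v \<psi> v)" if "range \<psi> \<subseteq> diagram_carrier L" for \<psi>
    using holds that by (simp add: holds_in_Cob1_iff[OF L(1)])
  have count: "length (occs z u) = length (occs z v)" for z
  proof -
    have "range (counter z) \<subseteq> diagram_carrier L"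
      using L by (auto simp: counter_def diagram_carrier_def)
    from eq[OF this] show ?thesis by (simp add: counter_value)
  qed
  have "vars u = vars v"
    using count by (metis length_0_conv occs_eq_Nil_iff subset_antisym subsetI)
  show "profile u x y = profile v x y"
  proof (cases "y \<in> vars u")
    case True
    then have v: "y \<in> vars v" using \<open>vars u = vars v\<close> by simp
    have probe: "range (probe x y 0) \<subseteq> diagram_carrier L" "range (probe x y 1) \<subseteq> diagram_carrier L"
      using L by (auto simp: probe_def diagram_carrier_def)
    have c: "length (occs x (before y u)) = length (occs x (before y v)) \<and>
        length (occs x (after y u)) = length (occs x (after y v))"
      using eq[OF probe(1)] probe_value[OF True, of L x 0] probe_value[OF v, of L x 0] by auto
    then have s: "(hd (occs y u) = Var y \<longleftrightarrow> hd (occs y v) = Var y) \<and>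
        (last (occs y u) = Var y \<longleftrightarrow> last (occs y v) = Var y)"
      using eq[OF probe(2)] probe_value[OF True, of L x 1] probe_value[OF v, of L x 1]
      by (auto split: if_splits)
    have ends: "var_of (hd (occs y w)) = y" "var_of (last (occs y w)) = y" if "y \<in> vars w" for w
      using that hd_in_set[of "occs y w"] last_in_set[of "occs y w"] by auto
    have "hd (occs y u) = hd (occs y v)"
      by (rule occ_letter_eqI[OF ends(1)[OF True] ends(1)[OF v] conjunct1[OF s]])
    moreover have "last (occs y u) = last (occs y v)"
      by (rule occ_letter_eqI[OF ends(2)[OF True] ends(2)[OF v] conjunct2[OF s]])
    ultimately show ?thesis
      using c count True v by (simp add: profile_def)
  next
    case False
    have "before y w = w \<and> after y w = w" if "y \<notin> vars w" for w
      using that by (induction w) auto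
    then show ?thesis
      using count False \<open>vars u = vars v\<close> by (simp add: profile_def)
  qed
qed

lemma holds_if_middle_steps:
  assumes "middle_step\<^sup>*\<^sup>* u v"
  shows "holds_in (L2 L) (u, v)"
proof -
  have "word_value (L2 L) \<psi> u = word_value (L2 L) \<psi> v" for \<psi>
    using assms by (induction rule: rtranclp_induct) (auto dest: middle_step_L2)
  then show ?thesis by (simp add: holds_in_def)
qed

lemma holds_in_Cob1_if_L2:
  assumes "0 \<in> L" "holds_in (L2 L) p"
  shows "holds_in (Cob1 L) p"
  using assms(2) unfolding holds_in_Cob1_iff[OF assms(1)] by (auto simp: holds_in_def)

text \<open>A detour through the cobordism monoid, which spares a combinatorial argument: middle steps
  give identities, and identities determine the profile.\<close>

lemma profile_middle_steps:
  assumes "middle_step\<^sup>*\<^sup>* u v"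
  shows "profile u = profile v"
  by (rule profile_eq_if_holds[of UNIV])
    (use assms in \<open>auto intro: holds_in_Cob1_if_L2 holds_if_middle_steps\<close>)

section \<open>Words with equal profiles\<close>

lemma move_middle_letter:
  assumes "vars c \<subseteq> vars p \<inter> vars d" "var_of l \<in> vars p \<inter> vars d" "var_of l \<notin> vars c"
  shows "middle_step\<^sup>*\<^sup>* (p @ c @ l # d) (p @ l # c @ d)"
  using assms
proof (induction c arbitrary: p)
  case (Cons m c)
  have "middle_step\<^sup>*\<^sup>* ((p @ [m]) @ c @ l # d) ((p @ [m]) @ l # c @ d)"
    using Cons.prems by (intro Cons.IH) auto
  moreover have "middle_step (p @ m # l # (c @ d)) (p @ l # m # (c @ d))"
    using Cons.prems by (intro middle_step.swap) auto
  ultimately show ?case by simp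
qed auto

text \<open>Let \<open>x\<close> be the variable of the middle occurrence \<open>l\<close>, and \<open>c\<close> the part of \<open>v\<close> before its first
  \<open>x\<close>. If \<open>c\<close> contained the first or the last occurrence of some \<open>y\<close>, then the two words would have
  different numbers of \<open>x\<close> before the first \<open>y\<close> or after the last \<open>y\<close>, because in the left-hand
  word \<open>l\<close> stands before that \<open>y\<close>. So every letter of \<open>c\<close> is a middle occurrence, over which the
  \<open>x\<close> that follows \<open>c\<close> can be moved.\<close>

lemma next_middle_letter:
  assumes eq: "profile (p @ l # u) = profile (p @ v)"
    and l: "var_of l \<in> vars p" "var_of l \<in> vars u"
  obtains c m d where "v = c @ m # d" "var_of m = var_of l" "var_of l \<notin> vars c"
    "var_of l \<in> vars d" "vars c \<subseteq> vars p \<inter> vars d"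
proof -
  define x where "x = var_of l"
  have count: "length (occs z (p @ l # u)) = length (occs z (p @ v))" for z
    using profile_eqD(1)[OF eq] .
  have "length (occs x v) = Suc (length (occs x u))" "occs x u \<noteq> []"
    using count[of x] l by (auto simp: x_def)
  then have v2: "length (occs x v) \<ge> 2"
    by (cases "occs x u") auto
  then have "x \<in> vars v"
    by (metis occs_eq_Nil_iff list.size(3) not_numeral_le_zero)
  then have ex: "\<exists>m\<in>set v. var_of m = x" by (auto simp: vars_def)
  obtain c m d where v: "v = c @ m # d" and m: "var_of m = x" and c: "\<forall>k\<in>set c. var_of k \<noteq> x"
    using split_list_first_prop[OF ex] by blast
  have xc: "x \<notin> vars c" using c by (auto simp: vars_def)
  then have occs_c: "occs x c = []" by simp
  have xd: "x \<in> vars d"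
    using v2 by (cases "x \<in> vars d") (simp_all add: v m occs_c)
  have "y \<in> vars p \<inter> vars d" if y: "y \<in> vars c" for y
  proof (intro IntI)
    have [simp]: "x \<noteq> y" "y \<noteq> x" using y xc by auto
    have yv: "y \<in> vars v" using y v by simp
    then have yu: "y \<in> vars (p @ l # u)" using profile_vars[OF eq] by auto
    show "y \<in> vars p"
    proof (rule ccontr)
      assume yp: "y \<notin> vars p"
      have "length (occs x (before y (p @ v))) = length (occs x p) + length (occs x (before y c))"
        using yp y by (simp add: v before_append)
      also have "occs x (before y c) = []"
        using c unfolding before_def filter_empty_conv by (metis set_takeWhileD)
      finally show False
        using profile_eqD(2)[OF eq, of x y] yp by (simp add: before_append x_def[symmetric])
    qed
    show "y \<in> vars d"
    proof (rule ccontr)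
      assume yd: "y \<notin> vars d"
      have "occs x (after y (p @ v)) = occs x (after y c @ m # d)"
        using y yd m by (simp add: v after_append)
      also have "length \<dots> \<ge> length (occs x v)"
        by (simp add: v m occs_c)
      finally have *: "length (occs x (after y (p @ v))) \<ge> length (occs x v)" .
      have "y \<in> vars u"
      proof (rule ccontr)
        assume yu': "y \<notin> vars u"
        then have "length (occs y p) = length (occs y p) + length (occs y v)"
          using count[of y] by (simp add: x_def[symmetric])
        then show False using yv by simp
      qed
      then have "length (occs x (after y (p @ l # u))) \<le> length (occs x u)"
        by (simp add: after_append length_occs_after_le)
      then show False
        using * profile_eqD(3)[OF eq, of x y] \<open>length (occs x v) = Suc (length (occs x u))\<close> by simp
    qed
  qed
  then show thesis
    using that[of c m d] v m xc xd by (auto simp: x_def)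
qed

text \<open>Let \<open>x\<close> be the variable of \<open>l\<close>. If \<open>v\<close> began with another variable \<open>z\<close>, then the two words would
  have different numbers of \<open>z\<close> before the first \<open>x\<close> or after the last \<open>x\<close>. As a first or a last
  occurrence, \<open>l\<close> has its star fixed by the profile.\<close>

lemma next_outer_letter:
  assumes eq: "profile (p @ l # u) = profile (p @ v)"
    and l: "var_of l \<notin> vars p \<or> var_of l \<notin> vars u"
  obtains w where "v = l # w"
proof -
  define x where "x = var_of l"
  have count: "length (occs z (l # u)) = length (occs z v)" for z
    using profile_eqD(1)[OF eq, of z] by simp
  have "v \<noteq> []" using count[of x] by (auto simp: x_def)
  then obtain m w where v: "v = m # w" by (cases v) auto
  have xv: "x \<in> vars v" using count[of x] by (metis occs_eq_Nil_iff length_0_conv vars_simps(2) insertI1 x_def)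
  have "var_of m = x"
  proof (rule ccontr)
    assume mx: "var_of m \<noteq> x"
    then have xw: "x \<in> vars w" using xv v by auto
    show False
    proof (cases "x \<in> vars p")
      case False
      then show False
        using profile_eqD(2)[OF eq, of "var_of m" x] mx
        by (simp add: v before_append x_def[symmetric])
    next
      case True
      then have "x \<notin> vars u" using l x_def by auto
      then have "length (occs (var_of m) u) = length (occs (var_of m) (after x w))"
        using profile_eqD(3)[OF eq, of "var_of m" x] xw
        by (simp add: v after_append x_def[symmetric])
      moreover have "length (occs (var_of m) u) = Suc (length (occs (var_of m) w))"
        using count[of "var_of m"] mx by (simp add: v x_def[symmetric])
      ultimately show False
        using length_occs_after_le[of "var_of m" x w] by simp
    qed
  qed
  moreover have "m = l"
  proof (cases "x \<in> vars p")
    case False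
    then show ?thesis
      using profile_eqD(4)[OF eq, of x] \<open>var_of m = x\<close> 
      by (simp add: v x_def[symmetric] hd_append)
  next
    case True
    then have xu: "x \<notin> vars u" using l x_def by auto
    then have "length (occs x w) = 0"
      using count[of x] \<open>var_of m = x\<close> by (simp add: v x_def[symmetric])
    then have "occs x w = []" by (simp only: length_0_conv)
    then show ?thesis
      using profile_eqD(5)[OF eq, of x] \<open>var_of m = x\<close> xu
      by (simp add: v x_def[symmetric])
  qed
  ultimately show thesis using that v by blast
qed

text \<open>The induction extends the common prefix by one letter, as whether a letter is a middle
  occurrence depends on the letters before it.\<close>

lemma middle_steps_after_prefix:
  "profile (p @ u) = profile (p @ v) \<Longrightarrow> middle_step\<^sup>*\<^sup>* (p @ v) (p @ u)"
proof (induction u arbitrary: p v)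
  case Nil
  have "length (occs x v) = 0" for x
    using profile_eqD(1)[OF Nil, of x] by simp
  then have "vars v = {}" by auto
  then show ?case by (simp add: vars_def)
next
  case (Cons l u)
  show ?case
  proof (cases "var_of l \<in> vars p \<and> var_of l \<in> vars u")
    case True
    then obtain c m d where v: "v = c @ m # d" and m: "var_of m = var_of l"
      and c: "var_of l \<notin> vars c" "var_of l \<in> vars d" "vars c \<subseteq> vars p \<inter> vars d"
      using next_middle_letter[OF Cons.prems] by blast
    have "middle_step\<^sup>*\<^sup>* (p @ c @ m # d) (p @ m # c @ d)"
      using c m True by (intro move_middle_letter) auto
    also have "middle_step (p @ m # (c @ d)) (p @ l # (c @ d))"
      using c m True by (intro middle_step.restar) auto
    finally have steps: "middle_step\<^sup>*\<^sup>* (p @ v) ((p @ [l]) @ c @ d)"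
      by (simp add: v)
    moreover have "middle_step\<^sup>*\<^sup>* ((p @ [l]) @ c @ d) ((p @ [l]) @ u)"
      using Cons.prems profile_middle_steps[OF steps] by (intro Cons.IH) simp
    ultimately show ?thesis by simp
  next
    case False
    then obtain w where "v = l # w"
      using next_outer_letter[OF Cons.prems] by blast
    then show ?thesis
      using Cons.IH[of "p @ [l]" w] Cons.prems by simp
  qed
qed

lemma middle_steps_if_same_profile:
  "profile u = profile v \<Longrightarrow> middle_step\<^sup>*\<^sup>* v u"
  using middle_steps_after_prefix[of "[]"] by simp

text \<open>An identity of the cobordism monoid forces equal profiles, equal profiles give middle steps, middle
  steps give an identity of the diagram monoid, and this passes to its image. Hence
  both monoids, over either set of labels, have the same identities.\<close>

theorem holds_in_Cob1_iff_middle_steps: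
  assumes "0 \<in> L" "1 \<in> L"
  shows "holds_in (Cob1 L) (u, v) \<longleftrightarrow> middle_step\<^sup>*\<^sup>* u v"
  using assms middle_steps_if_same_profile profile_eq_if_holds
    holds_in_Cob1_if_L2 holds_if_middle_steps by metis

theorem holds_in_L2_iff_middle_steps:
  assumes "0 \<in> L" "1 \<in> L"
  shows "holds_in (L2 L) (u, v) \<longleftrightarrow> middle_step\<^sup>*\<^sup>* u v"
  using assms middle_steps_if_same_profile profile_eq_if_holds
    holds_in_Cob1_if_L2 holds_if_middle_steps by metis

section \<open>Evaluating words in involutory semigroups\<close>

text \<open>Letters are replaced by words, possibly empty ones; a starred letter becomes the formal
  involution of the word.\<close>

fun subst :: "(nat \<Rightarrow> word) \<Rightarrow> letter \<Rightarrow> word" where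
  "subst \<sigma> (Var x) = \<sigma> x"
| "subst \<sigma> (Star x) = map flip (rev (\<sigma> x))"

lemma word_value_Cons:
  "w \<noteq> [] \<Longrightarrow> word_value M \<phi> (l # w) = letter_value M \<phi> l \<otimes>\<^bsub>M\<^esub> word_value M \<phi> w"
  by (cases w) auto

context involutory_semigroup
begin

lemma letter_value_closed: "range \<phi> \<subseteq> carrier M \<Longrightarrow> letter_value M \<phi> l \<in> carrier M"
  by (cases l) (auto intro!: star_closed)

lemma letter_value_flip:
  "range \<phi> \<subseteq> carrier M \<Longrightarrow> letter_value M \<phi> (flip l) = star M (letter_value M \<phi> l)"
  by (cases l) (auto simp: star_star range_subsetD)

lemma word_value_closed:
  "w \<noteq> [] \<Longrightarrow> range \<phi> \<subseteq> carrier M \<Longrightarrow> word_value M \<phi> w \<in> carrier M"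
proof (induction w)
  case (Cons l w)
  then show ?case
    by (cases "w = []") (auto simp: word_value_Cons letter_value_closed mult_closed)
qed simp

lemma word_value_append:
  assumes "range \<phi> \<subseteq> carrier M" "u \<noteq> []" "v \<noteq> []"
  shows "word_value M \<phi> (u @ v) = word_value M \<phi> u \<otimes> word_value M \<phi> v"
  using assms(2)
proof (induction u)
  case (Cons l u)
  then show ?case
    using assms by (cases "u = []")
      (auto simp: word_value_Cons letter_value_closed word_value_closed mult_assoc)
qed simp

lemma word_value_context:
  assumes "range \<phi> \<subseteq> carrier M" "u \<noteq> []" "v \<noteq> []" "word_value M \<phi> u = word_value M \<phi> v"
  shows "word_value M \<phi> (a @ u @ b) = word_value M \<phi> (a @ v @ b)"
  using assms by (cases "a = []"; cases "b = []") (simp_all add: word_value_append)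

lemma word_value_star:
  assumes "range \<phi> \<subseteq> carrier M" "w \<noteq> []"
  shows "word_value M \<phi> (map flip (rev w)) = star M (word_value M \<phi> w)"
  using assms(2)
proof (induction w)
  case (Cons l w)
  then show ?case
    using assms(1) by (cases "w = []")
      (simp_all add: word_value_append word_value_Cons letter_value_flip star_mult
        letter_value_closed word_value_closed)
qed simp

lemma word_value_subst:
  assumes \<phi>: "range \<phi> \<subseteq> carrier M"
    and "w \<noteq> []" "\<And>l. l \<in> set w \<Longrightarrow> \<sigma> (var_of l) \<noteq> []"
    and \<phi>': "\<And>x. \<sigma> x \<noteq> [] \<Longrightarrow> \<phi>' x = word_value M \<phi> (\<sigma> x)"
  shows "word_value M \<phi>' w = word_value M \<phi> (concat (map (subst \<sigma>) w))"
  using assms(2,3)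
proof (induction w)
  case (Cons l w)
  have "\<sigma> (var_of l) \<noteq> []" using Cons.prems(2) by simp
  then have l: "letter_value M \<phi>' l = word_value M \<phi> (subst \<sigma> l)"
    by (cases l) (simp_all add: \<phi>' word_value_star[OF \<phi>])
  have ne: "subst \<sigma> k \<noteq> []" if "k \<in> set (l # w)" for k
    using Cons.prems(2)[OF that] by (cases k) auto
  show ?case
  proof (cases "w = []")
    case False
    then have "concat (map (subst \<sigma>) w) \<noteq> []"
      using ne by (cases w) auto
    with False show ?thesis
      using Cons ne l by (simp add: word_value_append[OF \<phi>] word_value_Cons)
  qed (simp add: l)
qed simp

text \<open>In a semigroup a variable cannot be given the empty word as its value. Hence a substitution with
  empty words is applied to the identity from which the variables concerned have been deleted.\<close>

lemma holds_in_instance: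
  assumes holds: "holds_in M (delete_letters {x. \<sigma> x = []} (s, t))"
    and \<phi>: "range \<phi> \<subseteq> carrier M"
    and starred: "\<And>x. Star x \<in> set s \<union> set t \<Longrightarrow> \<sigma> x \<noteq> []"
    and nonempty: "concat (map (subst \<sigma>) s) \<noteq> []" "concat (map (subst \<sigma>) t) \<noteq> []"
  shows "word_value M \<phi> (a @ concat (map (subst \<sigma>) s) @ b) =
    word_value M \<phi> (a @ concat (map (subst \<sigma>) t) @ b)"
proof (rule word_value_context[OF \<phi> nonempty])
  let ?f = "filter (\<lambda>l. l \<notin> Var ` {x. \<sigma> x = []})"
  \<comment> \<open>The value at a deleted variable is arbitrary, but has to lie in the carrier.\<close>
  define \<phi>' where "\<phi>' x = (if \<sigma> x = [] then \<phi> 0 else word_value M \<phi> (\<sigma> x))" for x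
  have \<phi>': "range \<phi>' \<subseteq> carrier M"
    using \<phi> by (auto simp: \<phi>'_def word_value_closed)
  have deleted: "concat (map (subst \<sigma>) w) = concat (map (subst \<sigma>) (?f w))" for w
    by (induction w) auto
  have "word_value M \<phi>' (?f w) = word_value M \<phi> (concat (map (subst \<sigma>) w))"
    if "w = s \<or> w = t" for w
    unfolding deleted[of w]
  proof (rule word_value_subst[OF \<phi>])
    show "?f w \<noteq> []"
      using that nonempty deleted[of w] by auto
    fix l assume "l \<in> set (?f w)"
    then have l: "l \<in> set w" "l \<notin> Var ` {x. \<sigma> x = []}" by simp_all
    show "\<sigma> (var_of l) \<noteq> []"
    proof (cases l)
      case (Var x)
      with l(2) show ?thesis by auto
    next
      case (Star x)
      with l(1) that have "Star x \<in> set s \<union> set t" by auto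
      with starred Star show ?thesis by simp
    qed
  qed (simp add: \<phi>'_def)
  moreover have "word_value M \<phi>' (?f s) = word_value M \<phi>' (?f t)"
    using holds \<phi>' by (simp add: holds_in_def delete_letters_def Let_def)
  ultimately show "word_value M \<phi> (concat (map (subst \<sigma>) s)) = word_value M \<phi> (concat (map (subst \<sigma>) t))"
    by simp
qed

end

locale semigroup_basis_model = involutory_semigroup +
  assumes basis: "p \<in> semigroup_basis \<Longrightarrow> holds_in M p"
begin

text \<open>Once the middle letter is compared with the last one \<open>g\<close>, only the first letter \<open>e\<close> can vary:
  (III) deals with \<open>e = g\<close>, and (IV) with \<open>e = g\<^sup>*\<close>.\<close>

lemma restar_to_last:
  assumes \<phi>: "range \<phi> \<subseteq> carrier M" and e: "var_of e = var_of l" "var_of g = var_of l"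
  shows "word_value M \<phi> (a @ (e # t1 @ l # t2 @ [g]) @ b) =
    word_value M \<phi> (a @ (e # t1 @ g # t2 @ [g]) @ b)"
proof (cases "l = g")
  case False
  with e have l: "l = flip g" and e: "e = g \<or> e = flip g"
    by (metis same_var_of)+
  define \<sigma> where "\<sigma> = (\<lambda>_. [Var 0])(vx := [e], vt1 := t1, vt2 := t2)"
  have T: "{x. \<sigma> x = []} \<subseteq> {vt1, vt2}"
    by (auto simp: \<sigma>_def split: if_splits)
  from e show ?thesis
  proof
    assume [simp]: "e = g"
    have "holds_in M (delete_letters {x. \<sigma> x = []} identity_III)"
      using T by (intro basis) (unfold semigroup_basis_def, blast)
    from holds_in_instance[OF this[unfolded identity_III_def] \<phi>, of a b]
    show ?thesis by (simp add: \<sigma>_def l)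
  next
    assume [simp]: "e = flip g"
    have "holds_in M (delete_letters {x. \<sigma> x = []} identity_IV)"
      using T by (intro basis) (unfold semigroup_basis_def, blast)
    from holds_in_instance[OF this[unfolded identity_IV_def] \<phi>, of a b]
    show ?thesis by (simp add: \<sigma>_def l)
  qed
qed simp

lemma restar_middle:
  assumes \<phi>: "range \<phi> \<subseteq> carrier M" and l: "var_of l = var_of m" "var_of l \<in> vars u \<inter> vars v"
  shows "word_value M \<phi> (u @ l # v) = word_value M \<phi> (u @ m # v)"
proof -
  obtain a e t1 where u: "u = a @ e # t1" "var_of e = var_of l"
    using l(2) by (auto elim: split_at_var)
  obtain t2 g b where v: "v = t2 @ g # b" "var_of g = var_of l"
    using l(2) by (auto elim: split_at_var)
  show ?thesis
    using restar_to_last[OF \<phi>, of e l g a t1 t2 b] restar_to_last[OF \<phi>, of e m g a t1 t2 b] u v l(1)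
    by simp
qed

lemma star_occurrences_holds:
  assumes "i \<in> {0, 1, 3}" "j \<in> {0, 1, 3}" "p = identity_I \<or> p = identity_II" "T \<subseteq> {vt1, vt2, vt3, vt4}"
  shows "holds_in M (delete_letters T (star_occurrences i j p))"
  using assms by (intro basis) (unfold semigroup_basis_def identities_I_II_def, blast)

text \<open>If the middle letters carry the same stars as the last ones, then it is enough to substitute these
  for \<open>x\<close> and \<open>y\<close>; the first letters may then need a star, which is the choice of 0 or 1 for the
  indices of (I) and (II).\<close>

lemma swap_last_copies:
  assumes \<phi>: "range \<phi> \<subseteq> carrier M" and "var_of e = var_of l" "var_of f = var_of m"
    and "w = t3 @ m # t4 @ [l] \<or> w = t3 @ l # t4 @ [m]"
  shows "word_value M \<phi> (a @ (e # t1 @ f # t2 @ l # m # w) @ b) =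
    word_value M \<phi> (a @ (e # t1 @ f # t2 @ m # l # w) @ b)"
proof -
  define \<sigma> where "\<sigma> = (\<lambda>_. [Var 0])(vx := [l], vt1 := t1, vt2 := t2, vt3 := t3, vt4 := t4, vy := [m])"
  have T: "{x. \<sigma> x = []} \<subseteq> {vt1, vt2, vt3, vt4}"
    by (auto simp: \<sigma>_def split: if_splits)
  \<comment> \<open>The index is 1 exactly if the first occurrence has the other star than the last one.\<close>
  define i :: nat where "i = (if e = l then 0 else 1)"
  define j :: nat where "j = (if f = m then 0 else 1)"
  have ij: "i \<in> {0, 1, 3}" "j \<in> {0, 1, 3}" by (auto simp: i_def j_def)
  have e: "e = (if i = 0 then l else flip l)" and f: "f = (if j = 0 then m else flip m)"
    using iffD1[OF same_var_of assms(2)] iffD1[OF same_var_of assms(3)] by (auto simp: i_def j_def)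
  have ij': "i = 0 \<or> i = 1" "j = 0 \<or> j = 1" by (auto simp: i_def j_def)
  have inst: "word_value M \<phi> (a @ concat (map (subst \<sigma>) s) @ b) =
      word_value M \<phi> (a @ concat (map (subst \<sigma>) t) @ b)"
    if "holds_in M (delete_letters {x. \<sigma> x = []} (s, t))"
      and xy: "\<forall>k\<in>set s \<union> set t. \<forall>x. k = Star x \<longrightarrow> x = vx \<or> x = vy"
      and "concat (map (subst \<sigma>) s) \<noteq> []" "concat (map (subst \<sigma>) t) \<noteq> []" for s t
  proof (rule holds_in_instance[OF that(1) \<phi> _ that(3,4)])
    fix x assume "Star x \<in> set s \<union> set t"
    with xy have "x = vx \<or> x = vy" by blast
    then show "\<sigma> x \<noteq> []" by (auto simp: \<sigma>_def)
  qed
  from assms(4) show ?thesis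
  proof
    assume w: "w = t3 @ m # t4 @ [l]"
    note h = star_occurrences_holds[OF ij disjI1[OF refl] T,
        unfolded star_occurrences_def Let_def identity_I_def map_prod_simp]
    show ?thesis
      using inst[OF h] ij'
      by (elim disjE) (simp_all add: \<sigma>_def w e f)
  next
    assume w: "w = t3 @ l # t4 @ [m]"
    note h = star_occurrences_holds[OF ij disjI2[OF refl] T,
        unfolded star_occurrences_def Let_def identity_II_def map_prod_simp]
    show ?thesis
      using inst[OF h] ij'
      by (elim disjE) (simp_all add: \<sigma>_def w e f)
  qed
qed

text \<open>Both letters are first given the stars of a later occurrence, then swapped, then given back their
  own stars. If the chosen earlier occurrences are in the order opposite to that of the letters,
  then the identity is used from right to left, with \<open>x\<close> and \<open>y\<close> interchanged; the order of the
  later occurrences decides between (I) and (II).\<close>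

lemma swap_middle:
  assumes \<phi>: "range \<phi> \<subseteq> carrier M" and lm: "var_of l \<noteq> var_of m"
    and mid: "{var_of l, var_of m} \<subseteq> vars u \<inter> vars v"
  shows "word_value M \<phi> (u @ l # m # v) = word_value M \<phi> (u @ m # l # v)"
proof -
  have "\<exists>t3 t4 g h b w. v = w @ b \<and> var_of g = var_of l \<and> var_of h = var_of m \<and>
      (w = t3 @ h # t4 @ [g] \<or> w = t3 @ g # t4 @ [h])"
  proof (rule split_at_two_vars[of "var_of l" v "var_of m"])
    fix c g d h r
    assume "v = c @ g # d @ h # r" "var_of g = var_of l" "var_of h = var_of m"
    then show ?thesis
      by (intro exI[of _ c] exI[of _ d] exI[of _ g] exI[of _ h] exI[of _ r] exI[of _ "c @ g # d @ [h]"]) simp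
  next
    fix c g d h r
    assume "v = c @ h # d @ g # r" "var_of g = var_of l" "var_of h = var_of m"
    then show ?thesis
      by (intro exI[of _ c] exI[of _ d] exI[of _ g] exI[of _ h] exI[of _ r] exI[of _ "c @ h # d @ [g]"]) simp
  qed (use mid lm in auto)
  then obtain t3 t4 g h b w where v: "v = w @ b" and gh: "var_of g = var_of l" "var_of h = var_of m"
    and w: "w = t3 @ h # t4 @ [g] \<or> w = t3 @ g # t4 @ [h]"
    by blast
  have "word_value M \<phi> (u @ g # h # v) = word_value M \<phi> (u @ h # g # v)"
  proof (rule split_at_two_vars[of "var_of l" u "var_of m"])
    fix a e t1 f t2
    assume "u = a @ e # t1 @ f # t2" "var_of e = var_of l" "var_of f = var_of m"
    then show ?thesis
      using swap_last_copies[OF \<phi>, of e g f h w t3 t4 a t1 t2 b] gh w by (simp add: v)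
  next
    fix a e t1 f t2
    assume "u = a @ f # t1 @ e # t2" "var_of e = var_of l" "var_of f = var_of m"
    then show ?thesis
      using swap_last_copies[OF \<phi>, of f h e g w t3 t4 a t1 t2 b] gh w by (auto simp add: v)
  qed (use mid lm in auto)
  moreover have restar2: "word_value M \<phi> (u @ k # n # v) = word_value M \<phi> (u @ k' # n' # v)"
    if "var_of k = var_of k'" "var_of n = var_of n'"
      "{var_of k, var_of n} \<subseteq> vars u \<inter> vars v" for k k' n n'
    using restar_middle[OF \<phi>, of k k' u "n # v"] restar_middle[OF \<phi>, of n n' "u @ [k']" v] that
    by simp
  moreover have "word_value M \<phi> (u @ l # m # v) = word_value M \<phi> (u @ g # h # v)"
    using gh mid by (intro restar2) simp_all
  moreover have "word_value M \<phi> (u @ m # l # v) = word_value M \<phi> (u @ h # g # v)"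
    using gh mid by (intro restar2) simp_all
  ultimately show ?thesis by simp
qed

lemma middle_step_value:
  "middle_step u v \<Longrightarrow> range \<phi> \<subseteq> carrier M \<Longrightarrow> word_value M \<phi> u = word_value M \<phi> v"
  by (induction rule: middle_step.induct) (auto intro: swap_middle restar_middle)

lemma middle_steps_hold:
  assumes "middle_step\<^sup>*\<^sup>* u v"
  shows "holds_in M (u, v)"
proof -
  have "word_value M \<phi> u = word_value M \<phi> v" if "range \<phi> \<subseteq> carrier M" for \<phi>
    using assms by (induction rule: rtranclp_induct) (auto dest: middle_step_value[OF _ that])
  then show ?thesis by (simp add: holds_in_def)
qed

end

section \<open>The two bases\<close>

lemma filter_vars: "vars (filter (\<lambda>l. l \<notin> Var ` T) w) \<supseteq> vars w - T"
  by (fastforce simp: vars_def)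

lemma middle_step_delete_swap:
  assumes "var_of l \<noteq> var_of m" "{var_of l, var_of m} \<subseteq> (vars u \<inter> vars v) - T"
  shows "middle_step (fst (delete_letters T (u @ l # m # v, u @ m # l # v)))
    (snd (delete_letters T (u @ l # m # v, u @ m # l # v)))"
proof -
  have "l \<notin> Var ` T" "m \<notin> Var ` T" using assms(2) by auto
  then show ?thesis
    using assms filter_vars[of u T] filter_vars[of v T]
    by (auto simp: delete_letters_def Let_def intro!: middle_step.swap)
qed

lemma middle_step_delete_restar:
  assumes "var_of l = var_of m" "var_of l \<in> (vars u \<inter> vars v) - T"
  shows "middle_step (fst (delete_letters T (u @ l # v, u @ m # v)))
    (snd (delete_letters T (u @ l # v, u @ m # v)))"
proof -
  have "l \<notin> Var ` T" "m \<notin> Var ` T" using assms by auto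
  then show ?thesis
    using assms filter_vars[of u T] filter_vars[of v T]
    by (auto simp: delete_letters_def Let_def intro!: middle_step.restar)
qed

lemma identities_I_II_swap:
  assumes "p \<in> identities_I_II"
  obtains u v where "p = (u @ Var vx # Var vy # v, u @ Var vy # Var vx # v)"
    "{vx, vy} \<subseteq> vars u \<inter> vars v" "\<And>x. Star x \<in> set (u @ v) \<Longrightarrow> x = vx \<or> x = vy"
proof -
  obtain i j q where p: "p = star_occurrences i j q" and ij: "i = 0 \<or> i = 1 \<or> i = 3" "j = 0 \<or> j = 1 \<or> j = 3"
    and q: "q = identity_I \<or> q = identity_II"
    using assms unfolding identities_I_II_def by auto
  define f where "f k n x = (if k = n then Star x else Var x)" for k n :: nat and x :: nat
  define u where "u = [f i 1 vx, Var vt1, f j 1 vy, Var vt2]"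
  define v where "v = (if q = identity_I then [Var vt3, f j 3 vy, Var vt4, f i 3 vx]
    else [Var vt3, f i 3 vx, Var vt4, f j 3 vy])"
  have "identity_I \<noteq> identity_II" by (simp add: identity_I_def identity_II_def)
  then have "p = (u @ Var vx # Var vy # v, u @ Var vy # Var vx # v)"
    using ij q unfolding p
    by (elim disjE) (simp_all add: star_occurrences_def Let_def u_def v_def f_def,
        simp_all add: identity_I_def identity_II_def numeral_3_eq_3)
  moreover have "var_of (f k n x) = x" for k n x
    by (simp add: f_def)
  then have "{vx, vy} \<subseteq> vars u \<inter> vars v"
    by (simp add: u_def v_def)
  moreover have "x = vx \<or> x = vy" if "Star x \<in> set (u @ v)" for x
    using that by (auto simp: u_def v_def f_def split: if_splits)
  ultimately show thesis by (rule that)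
qed

lemma semigroup_basis_middle_step:
  assumes "p \<in> semigroup_basis"
  shows "middle_step (fst p) (snd p)"
proof -
  from assms consider
    (swap) T q where "p = delete_letters T q" "T \<subseteq> {vt1, vt2, vt3, vt4}" "q \<in> identities_I_II"
    | (III) T where "p = delete_letters T identity_III" "T \<subseteq> {vt1, vt2}"
    | (IV) T where "p = delete_letters T identity_IV" "T \<subseteq> {vt1, vt2}"
    unfolding semigroup_basis_def by blast
  then show ?thesis
  proof cases
    case swap
    obtain u v where "q = (u @ Var vx # Var vy # v, u @ Var vy # Var vx # v)"
      "{vx, vy} \<subseteq> vars u \<inter> vars v"
      using identities_I_II_swap[OF swap(3)] by metis
    moreover have "vx \<notin> T" "vy \<notin> T" using swap(2) by auto
    ultimately show ?thesis
      using middle_step_delete_swap[of "Var vx" "Var vy" u v T] swap(1) by simp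
  next
    case III
    moreover have "vx \<notin> T" using III(2) by auto
    ultimately show ?thesis
      using middle_step_delete_restar[of "Star vx" "Var vx" "[Var vx, Var vt1]" "[Var vt2, Var vx]" T]
      by (auto simp: identity_III_def)
  next
    case IV
    moreover have "vx \<notin> T" using IV(2) by auto
    ultimately show ?thesis
      using middle_step_delete_restar[of "Star vx" "Var vx" "[Var vx, Var vt1]" "[Var vt2, Star vx]" T]
      by (auto simp: identity_IV_def)
  qed
qed

lemma monoid_basis_subset: "monoid_basis \<subseteq> semigroup_basis"
proof
  fix p assume "p \<in> monoid_basis"
  moreover have "p = delete_letters {} p" by (cases p) (simp add: delete_letters_def Let_def)
  ultimately show "p \<in> semigroup_basis"
    unfolding monoid_basis_def semigroup_basis_def by blast
qed

lemma finite_semigroup_basis: "finite semigroup_basis"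
proof -
  have "identities_I_II =
      (\<Union>i\<in>{0, 1, 3}. \<Union>j\<in>{0, 1, 3}. \<Union>p\<in>{identity_I, identity_II}. {star_occurrences i j p})"
    unfolding identities_I_II_def by blast
  then have finite: "finite identities_I_II" by (rule ssubst) simp
  have "semigroup_basis =
      (\<Union>T\<in>Pow {vt1, vt2, vt3, vt4}. \<Union>p\<in>identities_I_II. {delete_letters T p}) \<union>
      (\<Union>T\<in>Pow {vt1, vt2}. \<Union>p\<in>{identity_III, identity_IV}. {delete_letters T p})"
    unfolding semigroup_basis_def by blast
  then show ?thesis by (rule ssubst) (simp add: finite)
qed

text \<open>No star of a deleted variable may occur, since the filter only removes unstarred letters.\<close>

lemma (in involutory_monoid) word_value_delete:
  assumes \<phi>: "range \<phi> \<subseteq> carrier M" and "\<And>x. x \<in> T \<Longrightarrow> Star x \<notin> set w"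
  shows "word_value M \<phi> (filter (\<lambda>l. l \<notin> Var ` T) w) =
    word_value M (\<lambda>x. if x \<in> T then \<one> else \<phi> x) w"
proof -
  have closed: "word_value M \<psi> v \<in> carrier M" if "range \<psi> \<subseteq> carrier M" for \<psi> v
    using that by (cases "v = []") (auto intro: word_value_closed)
  have value_Cons: "word_value M \<psi> (l # v) = letter_value M \<psi> l \<otimes> word_value M \<psi> v"
    if "range \<psi> \<subseteq> carrier M" for \<psi> l v
    using letter_value_closed[OF that, of l] by (cases "v = []") (auto simp: word_value_Cons)
  have \<phi>': "range (\<lambda>x. if x \<in> T then \<one> else \<phi> x) \<subseteq> carrier M"
    using \<phi> by auto
  show ?thesis
    using assms(2)
  proof (induction w)
    case (Cons l w)
    then show ?case
      using closed[OF \<phi>'] by (cases l) (auto simp: value_Cons[OF \<phi>] value_Cons[OF \<phi>'])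
  qed simp
qed

lemma (in involutory_monoid) holds_in_delete_letters:
  assumes "holds_in M p" "\<And>x. x \<in> T \<Longrightarrow> Star x \<notin> set (fst p) \<union> set (snd p)"
  shows "holds_in M (delete_letters T p)"
  unfolding holds_in_def
proof (intro allI impI)
  fix \<phi> :: "nat \<Rightarrow> 'a" assume \<phi>: "range \<phi> \<subseteq> carrier M"
  then have "range (\<lambda>x. if x \<in> T then \<one> else \<phi> x) \<subseteq> carrier M" by auto
  then show "word_value M \<phi> (fst (delete_letters T p)) = word_value M \<phi> (snd (delete_letters T p))"
    using assms word_value_delete[OF \<phi>, of T "fst p"] word_value_delete[OF \<phi>, of T "snd p"]
    by (cases p) (auto simp: delete_letters_def holds_in_def)
qed

lemma (in involutory_monoid) semigroup_basis_model_if_monoid_basis: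
  assumes "\<And>p. p \<in> monoid_basis \<Longrightarrow> holds_in M p"
  shows "semigroup_basis_model M"
proof
  fix p assume "p \<in> semigroup_basis"
  then consider
    (swap) T q where "p = delete_letters T q" "T \<subseteq> {vt1, vt2, vt3, vt4}" "q \<in> identities_I_II"
    | (restar) T q where "p = delete_letters T q" "T \<subseteq> {vt1, vt2}" "q \<in> {identity_III, identity_IV}"
    unfolding semigroup_basis_def by blast
  then show "holds_in M p"
  proof cases
    case swap
    obtain u v where "q = (u @ Var vx # Var vy # v, u @ Var vy # Var vx # v)"
      "\<And>x. Star x \<in> set (u @ v) \<Longrightarrow> x = vx \<or> x = vy"
      using identities_I_II_swap[OF swap(3)] by metis
    then have "Star x \<notin> set (fst q) \<union> set (snd q)" if "x \<in> T" for x
      using that swap(2) by fastforce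
    moreover have "holds_in M q"
      using swap(3) by (intro assms) (simp add: monoid_basis_def)
    ultimately show ?thesis
      unfolding swap(1) by (intro holds_in_delete_letters)
  next
    case restar
    then show ?thesis
      using assms[of q] unfolding restar(1)
      by (intro holds_in_delete_letters) (auto simp: monoid_basis_def identity_III_def identity_IV_def)
  qed
qed

lemma bases_if_middle_steps:
  assumes S: "\<And>u v. holds_in S (u, v) \<longleftrightarrow> middle_step\<^sup>*\<^sup>* u v"
  shows "monoid_identity_basis TYPE('m) monoid_basis S"
    and "semigroup_identity_basis TYPE('m) semigroup_basis S"
    and "finitely_based TYPE('m) S"
proof -
  have holds: "holds_in S p" if "p \<in> semigroup_basis" for p
    using semigroup_basis_middle_step[OF that] S[of "fst p" "snd p"] by simp
  show monoid: "monoid_identity_basis TYPE('m) monoid_basis S"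
    unfolding monoid_identity_basis_def
  proof (intro conjI ballI allI impI)
    fix p and M :: "'m involutory"
    assume p: "holds_in S p" and M: "involutory_monoid M \<and> (\<forall>q\<in>monoid_basis. holds_in M q)"
    then interpret semigroup_basis_model M
      by (intro involutory_monoid.semigroup_basis_model_if_monoid_basis) auto
    show "holds_in M p"
      using middle_steps_hold[of "fst p" "snd p"] p S[of "fst p" "snd p"] by simp
  qed (use holds monoid_basis_subset in blast)
  show semigroup: "semigroup_identity_basis TYPE('m) semigroup_basis S"
    unfolding semigroup_identity_basis_def
  proof (intro conjI ballI allI impI)
    show "semigroup_basis \<subseteq> semigroup_identities"
      using semigroup_basis_middle_step middle_step_nonempty
      by (fastforce simp: semigroup_identities_def)
  next
    fix p and M :: "'m involutory"
    assume p: "holds_in S p" and M: "involutory_semigroup M \<and> (\<forall>q\<in>semigroup_basis. holds_in M q)"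
    then interpret semigroup_basis_model M
      by (intro semigroup_basis_model.intro semigroup_basis_model_axioms.intro) auto
    show "holds_in M p"
      using middle_steps_hold[of "fst p" "snd p"] p S[of "fst p" "snd p"] by simp
  qed (rule holds)
  show "finitely_based TYPE('m) S"
    using semigroup finite_semigroup_basis unfolding finitely_based_def by blast
qed

theorem theorem5p43:
  "finitely_based TYPE('m) (Cob1 \<nat>) \<and>
   finitely_based TYPE('m) (Cob1 UNIV) \<and>
   finitely_based TYPE('m) (L2 \<nat>) \<and>
   finitely_based TYPE('m) (L2 UNIV) \<and>
   monoid_identity_basis TYPE('m) monoid_basis (Cob1 \<nat>) \<and>
   monoid_identity_basis TYPE('m) monoid_basis (Cob1 UNIV) \<and>
   monoid_identity_basis TYPE('m) monoid_basis (L2 \<nat>) \<and>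
   monoid_identity_basis TYPE('m) monoid_basis (L2 UNIV) \<and>
   finite semigroup_basis \<and>
   semigroup_identity_basis TYPE('m) semigroup_basis (Cob1 \<nat>) \<and>
   semigroup_identity_basis TYPE('m) semigroup_basis (Cob1 UNIV) \<and>
   semigroup_identity_basis TYPE('m) semigroup_basis (L2 \<nat>) \<and>
   semigroup_identity_basis TYPE('m) semigroup_basis (L2 UNIV)"
  by (intro conjI bases_if_middle_steps finite_semigroup_basis
      holds_in_Cob1_iff_middle_steps holds_in_L2_iff_middle_steps) simp_all

end
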